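(* For every odd integer $d\ge 3$ and every prime power $q\ge d+2$, $$M(q,q-d)\ \ge\ \mathcal{S}_d(q).$$
   Context: For permutations $\pi,\sigma$ of the same $n$ symbols, the Hamming distance $hd(\pi,\sigma)$ is the number of positions $x$ with $\pi(x)\ne\sigma(x)$. $M(n,D)$ is the maximum size of a set of permutations on $n$ symbols in which any two distinct permutations have Hamming distance at least $D$. Let $q$ be a prime power, $\mathbb{F}_q$ the field with $q$ elements and $\mathcal{P}^1(\mathbb{F}_q)=\mathbb{F}_q\cup\{\infty\}$. Let $V,U$ be nonzero polynomials over $\mathbb{F}_q$ with $\gcd(V,U)=1$, of degrees $v,u$ and leading coefficients $a_v,b_u$. The rational function $V(x)/U(x)$ is evaluated on $\mathcal{P}^1(\mathbb{F}_q)$ as follows: at $a\in\mathbb{F}_q$ its value is $V(a)/U(a)$, understood as $\infty$ if $U(a)=0$; at $\infty$ its value is $\infty$ if $v>u$, $0$ if $v<u$, and $a_v/b_v$ if $v=u$. It is a permutation rational function (PRF) if it permutes $\mathcal{P}^1(\mathbb{F}_q)$. $P_{v,u}(q)$ is the set of PRFs $V(x)/U(x)$ (as rational functions, so $V/U$ and $(cV)/(cU)$ with $c\in\mathbb{F}_q\setminus\{0\}$ are the same element) with $\deg V=v$ and $\deg U=u$, and $N_{v,u}(q)=|P_{v,u}(q)|$. For odd $d$, $\mathcal{S}_d(q)=\sum N_{v,u}(q)$, the sum being over all pairs $(v,u)$ of non-negative integers such that: $v\le (d+1)/2$ if $v>u$; $u\le (d-3)/2$ if $v<u$; and $v=u\le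 (d-3)/2$ if $v=u$. *)

theory Defs
  imports
    "HOL-Combinatorics.Permutations"
    "HOL-Computational_Algebra.Polynomial"
    "HOL-Computational_Algebra.Fraction_Field"
    "HOL-Library.Cardinality"
begin

definition hamming_distance :: "'s set \<Rightarrow> ('s \<Rightarrow> 's) \<Rightarrow> ('s \<Rightarrow> 's) \<Rightarrow> nat" where
  "hamming_distance A \<pi> \<sigma> = card {x \<in> A. \<pi> x \<noteq> \<sigma> x}"

text \<open>The \<open>n\<close> symbols are taken to be \<open>0, \<dots>, n - 1\<close>.\<close>

definition is_perm_code :: "nat \<Rightarrow> nat \<Rightarrow> (nat \<Rightarrow> nat) set \<Rightarrow> bool" where
  "is_perm_code n D C \<longleftrightarrow>
     (\<forall>\<pi>\<in>C. \<pi> permutes {..<n}) \<and>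
     (\<forall>\<pi>\<in>C. \<forall>\<sigma>\<in>C. \<pi> \<noteq> \<sigma> \<longrightarrow> D \<le> hamming_distance {..<n} \<pi> \<sigma>)"

definition max_perm_code :: "nat \<Rightarrow> nat \<Rightarrow> nat" where
  "max_perm_code n D = Max {card C | C. is_perm_code n D C}"

text \<open>The maximum is over a finite nonempty set, so it is attained and bounds every code.\<close>

lemma finite_perm_code_cards: "finite {card C | C. is_perm_code n D C}"
proof (rule finite_subset)
  show "{card C | C. is_perm_code n D C} \<subseteq> card ` Pow {\<pi>. \<pi> permutes {..<n}}"
    by (auto simp: is_perm_code_def)
  show "finite (card ` Pow {\<pi>. \<pi> permutes {..<n}})"
    by (simp add: finite_permutations)
qed

lemma perm_code_card_le: "is_perm_code n D C \<Longrightarrow> card C \<le> max_perm_code n D"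
  unfolding max_perm_code_def by (rule Max_ge[OF finite_perm_code_cards]) blast

lemma max_perm_code_attained: "\<exists>C. is_perm_code n D C \<and> card C = max_perm_code n D"
proof -
  have "card {} \<in> {card C | C. is_perm_code n D C}"
    by (rule CollectI, rule exI[of _ "{}"]) (simp add: is_perm_code_def)
  then have "max_perm_code n D \<in> {card C | C. is_perm_code n D C}"
    unfolding max_perm_code_def by (intro Max_in finite_perm_code_cards) blast
  then show ?thesis by auto
qed

text \<open>The projective line over \<open>'a\<close> is \<open>'a option\<close>, with \<open>None\<close> in the role of \<open>\<infinity>\<close>.\<close>

fun ratfun_eval :: "'a::field poly \<Rightarrow> 'a poly \<Rightarrow> 'a option \<Rightarrow> 'a option" where
  "ratfun_eval V U (Some a) = (if poly U a = 0 then None else Some (poly V a / poly U a))"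
| "ratfun_eval V U None =
     (if degree V > degree U then None
      else if degree V < degree U then Some 0
      else Some (lead_coeff V / lead_coeff U))"

text \<open>
  A rational function is an element of the fraction field of \<open>'a poly\<close>, so that \<open>V/U\<close> and
  \<open>(c V)/(c U)\<close> are the same element.  Coprime representatives are unique up to such a scalar
  \<open>c\<close>, and by the next lemma their evaluation does not depend on it.
\<close>

lemma ratfun_eval_smult:
  fixes c :: "'a::field"
  assumes "c \<noteq> 0"
  shows "ratfun_eval (smult c V) (smult c U) x = ratfun_eval V U x"
  using assms by (cases x) auto

definition PRFs :: "nat \<Rightarrow> nat \<Rightarrow> 'a::field poly fract set" where
  "PRFs v u = {Fract V U | V U. V \<noteq> 0 \<and> U \<noteq> 0 \<and> coprime V U \<and>
                 degree V = v \<and> degree U = u \<and> bij (ratfun_eval V U)}"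

definition num_PRFs :: "'a::{field,finite} itself \<Rightarrow> nat \<Rightarrow> nat \<Rightarrow> nat" where
  "num_PRFs _ v u = card (PRFs v u :: 'a poly fract set)"

text \<open>
  Only meant for odd \<open>d \<ge> 3\<close>; then both divisions are exact and the subtraction does not truncate.
\<close>

definition PRF_degree_pairs :: "nat \<Rightarrow> (nat \<times> nat) set" where
  "PRF_degree_pairs d = {(v, u).
     (v > u \<and> v \<le> (d + 1) div 2) \<or>
     (v < u \<and> u \<le> (d - 3) div 2) \<or>
     (v = u \<and> v \<le> (d - 3) div 2)}"

definition PRF_sum :: "'a::{field,finite} itself \<Rightarrow> nat \<Rightarrow> nat" where
  "PRF_sum F d = (\<Sum>(v, u)\<in>PRF_degree_pairs d. num_PRFs F v u)"

text \<open>The index set and the sets being counted are finite, so neither the sum nor \<open>card\<close> degenerates.\<close>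

lemma finite_PRF_degree_pairs: "finite (PRF_degree_pairs d)"
  by (rule finite_subset[of _ "{..d + 1} \<times> {..d + 1}"]) (auto simp: PRF_degree_pairs_def)

lemma finite_PRFs: "finite (PRFs v u :: 'a::{field,finite} poly fract set)"
proof -
  have fin: "finite {p :: 'a poly. degree p \<le> n}" for n
  proof (rule finite_subset)
    show "{p :: 'a poly. degree p \<le> n} \<subseteq> Poly ` {xs. set xs \<subseteq> UNIV \<and> length xs \<le> Suc n}"
    proof
      fix p :: "'a poly"
      assume "p \<in> {p. degree p \<le> n}"
      then have "length (coeffs p) \<le> Suc n"
        by (cases "p = 0") (simp_all add: length_coeffs_degree)
      then show "p \<in> Poly ` {xs. set xs \<subseteq> UNIV \<and> length xs \<le> Suc n}"
        by (intro image_eqI[of _ _ "coeffs p"]) simp_all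
    qed
    show "finite (Poly ` {xs :: 'a list. set xs \<subseteq> UNIV \<and> length xs \<le> Suc n})"
      by (intro finite_imageI finite_lists_length_le) simp
  qed
  have "(PRFs v u :: 'a poly fract set)
      \<subseteq> case_prod Fract ` ({p. degree p \<le> v} \<times> {p. degree p \<le> u})"
    by (auto simp: PRFs_def)
  then show ?thesis
    by (rule finite_subset) (intro finite_imageI finite_cartesian_product fin)
qed

end

theory Submission
  imports Defs
begin

text \<open>
  A PRF is turned into a permutation of \<open>\<F>\<^sub>q\<close> by contraction: the value at a finite pole, if there
  is one, is replaced by the value at \<open>\<infinity>\<close>.  Distinct \<open>V/U\<close> and \<open>W/Z\<close> agree in at most
  \<open>deg (VZ - WU)\<close> points of \<open>\<F>\<^sub>q\<close>, and contraction creates at most one new agreement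
  for each of the two functions that does not fix \<open>\<infinity>\<close>.  The degree bounds on the pairs \<open>(v, u)\<close>
  balance these two effects: with \<open>k = (d + 1) / 2\<close>, the numbers of agreements are at most
  \<open>2k - 1 = d\<close> if both functions fix \<open>\<infinity>\<close>, \<open>(2k - 2) + 1 = d\<close> if exactly one does, and
  \<open>(2k - 4) + 2 = d - 1\<close> if neither does.
\<close>

text \<open>Euclid's algorithm: passing from \<open>(a, b)\<close> to \<open>(b, a mod b)\<close>
  keeps coprimality and shrinks the size of the second entry. Polynomials over any field are an
  instance.\<close>

lemma coprime_imp_bezout:
  fixes a b :: "'a::euclidean_ring"
  assumes "coprime a b"
  shows "\<exists>r s. r * a + s * b = 1"
  using assms
proof (induction "euclidean_size b" arbitrary: a b rule: less_induct)
  case less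
  show ?case
  proof (cases "b = 0")
    case True
    with less.prems have "a dvd 1" by simp
    then obtain r where "1 = a * r" by (rule dvdE)
    with True show ?thesis by (intro exI[of _ r] exI[of _ 0]) (simp add: mult.commute)
  next
    case False
    have "coprime b (a mod b)"
      using less.prems False by (simp add: coprime_commute)
    with less.hyps[of "a mod b" b] False mod_size_less[of b a]
    obtain r s where "r * b + s * (a mod b) = 1" by blast
    moreover have "a mod b = a - a div b * b"
      by (simp add: minus_div_mult_eq_mod)
    ultimately have "s * a + (r - s * (a div b)) * b = 1"
      by (simp add: algebra_simps)
    then show ?thesis by blast
  qed
qed

lemma coprime_dvd_mult_imp_dvd:
  fixes a b c :: "'a::euclidean_ring"
  assumes "coprime a b" and "a dvd b * c"
  shows "a dvd c"
proof -
  obtain r s where "r * a + s * b = 1"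
    using coprime_imp_bezout[OF assms(1)] by blast
  then have "c = r * a * c + s * (b * c)"
    by (metis distrib_right mult.assoc mult_1)
  also have "a dvd \<dots>"
    using assms(2) by simp
  finally show ?thesis .
qed

text \<open>After cross-multiplying, coprimality makes the numerators divide each other. The degree
  pair is thus an invariant of the fraction, so no PRF is counted twice in the sum.\<close>

lemma degree_eq_if_Fract_eq:
  fixes V U W Z :: "'a::field poly"
  assumes eq: "Fract V U = Fract W Z"
    and nz: "V \<noteq> 0" "U \<noteq> 0" "W \<noteq> 0" "Z \<noteq> 0"
    and cop: "coprime V U" "coprime W Z"
  shows "degree V = degree W" and "degree U = degree Z"
proof -
  have *: "V * Z = W * U"
    using eq nz by (simp add: eq_fract)
  have "V dvd W"
    by (rule coprime_dvd_mult_imp_dvd[OF cop(1)]) (metis * dvd_triv_left mult.commute)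
  moreover have "W dvd V"
    by (rule coprime_dvd_mult_imp_dvd[OF cop(2)]) (metis * dvd_triv_left mult.commute)
  ultimately show VW: "degree V = degree W"
    using nz by (intro order_antisym dvd_imp_degree_le)
  have "degree V + degree Z = degree W + degree U"
    using * nz by (metis degree_mult_eq)
  with VW show "degree U = degree Z" by simp
qed

lemma PRFs_disjoint:
  assumes "(v, u) \<noteq> (w, z)"
  shows "PRFs v u \<inter> PRFs w z = ({} :: 'a::field poly fract set)"
proof (rule equals0I)
  fix r :: "'a poly fract"
  assume "r \<in> PRFs v u \<inter> PRFs w z"
  then obtain V U W Z :: "'a poly"
    where r: "r = Fract V U" "r = Fract W Z"
      and "V \<noteq> 0" "U \<noteq> 0" "W \<noteq> 0" "Z \<noteq> 0" "coprime V U" "coprime W Z"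
      and deg: "degree V = v" "degree U = u" "degree W = w" "degree Z = z"
    unfolding PRFs_def by blast
  then have "v = w" "u = z"
    using degree_eq_if_Fract_eq[of V U W Z] by simp_all
  with assms show False by simp
qed

text \<open>For injective \<open>f\<close> the argument of \<open>the\<close> is a genuine value:
  \<open>f (Some x)\<close> and \<open>f None\<close> cannot both be \<open>None\<close>.\<close>

definition contract :: "('a option \<Rightarrow> 'a option) \<Rightarrow> 'a \<Rightarrow> 'a" where
  "contract f x = (case f (Some x) of Some y \<Rightarrow> y | None \<Rightarrow> the (f None))"

lemma bij_contract:
  fixes f :: "'a::finite option \<Rightarrow> 'a option"
  assumes "bij f"
  shows "bij (contract f)"
proof -
  have inj: "f x = f y \<Longrightarrow> x = y" for x y
    using assms by (simp add: bij_def inj_eq)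
  have "inj (contract f)"
  proof (rule injI)
    fix x y
    assume "contract f x = contract f y"
    \<comment> \<open>A value inherited from \<open>f None\<close> equals no value
      \<open>f (Some y)\<close>, and there is at most one finite pole.\<close>
    then show "x = y"
      using inj[of "Some x" "Some y"] inj[of "Some x" None] inj[of "Some y" None]
      by (cases "f (Some x)"; cases "f (Some y)"; cases "f None") (auto simp: contract_def)
  qed
  then show ?thesis
    by (simp add: bij_def finite_UNIV_inj_surj)
qed

lemma card_finite_poles_le:
  assumes "bij f"
  shows "card {x. f (Some x) = None} \<le> (if f None = None then 0 else 1)"
proof (cases "\<exists>a. f (Some a) = None")
  case True
  then obtain a where a: "f (Some a) = None" by blast
  have inj: "f x = f y \<Longrightarrow> x = y" for x y
    using assms by (simp add: bij_def inj_eq)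
  have "x = a" if "f (Some x) = None" for x
    using a that inj[of "Some x" "Some a"] by simp
  with a have "{x. f (Some x) = None} = {a}" by blast
  moreover have "f None \<noteq> None"
    using a inj[of None "Some a"] by auto
  ultimately show ?thesis by simp
next
  case False
  then have "{x. f (Some x) = None} = {}" by blast
  then show ?thesis by (simp only: card.empty zero_le)
qed

lemma card_contract_agreements_le:
  fixes f g :: "'a::finite option \<Rightarrow> 'a option"
  assumes "bij f" and "bij g"
  shows "card {x. contract f x = contract g x}
    \<le> card {x. f (Some x) = g (Some x)}
      + (if f None = None then 0 else 1) + (if g None = None then 0 else 1)"
proof -
  \<comment> \<open>Away from the finite poles both contractions copy values of \<open>f\<close> and
    \<open>g\<close>, so every new agreement sits at a pole.\<close>
  have "{x. contract f x = contract g x}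
    \<subseteq> {x. f (Some x) = g (Some x)} \<union> {x. f (Some x) = None} \<union> {x. g (Some x) = None}"
    by (auto simp: contract_def split: option.splits)
  then have "card {x. contract f x = contract g x}
    \<le> card ({x. f (Some x) = g (Some x)} \<union> {x. f (Some x) = None} \<union> {x. g (Some x) = None})"
    by (intro card_mono) auto
  also have "\<dots> \<le> card {x. f (Some x) = g (Some x)} + card {x. f (Some x) = None}
      + card {x. g (Some x) = None}"
    by (meson add_le_mono card_Un_le le_refl le_trans)
  finally show ?thesis
    using card_finite_poles_le[OF assms(1)] card_finite_poles_le[OF assms(2)] by linarith
qed

lemma card_ratfun_eval_agreements_le:
  fixes V U W Z :: "'a::field poly"
  assumes "U \<noteq> 0" and "Z \<noteq> 0" and "Fract V U \<noteq> Fract W Z"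
  shows "card {x. ratfun_eval V U (Some x) = ratfun_eval W Z (Some x)}
    \<le> max (degree V + degree Z) (degree W + degree U)"
proof -
  let ?p = "V * Z - W * U"
  have nz: "?p \<noteq> 0"
    using assms by (simp add: eq_fract)
  \<comment> \<open>A common pole is a zero of both \<open>U\<close> and \<open>Z\<close>, so
    agreements with value \<open>None\<close> are roots of \<open>?p\<close> too.\<close>
  have "card {x. ratfun_eval V U (Some x) = ratfun_eval W Z (Some x)} \<le> card {x. poly ?p x = 0}"
    using poly_roots_finite[OF nz]
    by (intro card_mono) (auto simp: field_simps split: if_splits)
  also have "\<dots> \<le> degree ?p"
    using nz by (rule card_poly_roots_bound)
  also have "\<dots> \<le> max (degree V + degree Z) (degree W + degree U)"
    by (intro degree_diff_le_max[THEN order_trans] max.mono degree_mult_le)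
  finally show ?thesis .
qed

lemma card_contract_ratfun_agreements_le:
  fixes V U W Z :: "'a::{field,finite} poly"
  assumes "odd d" and "d \<ge> 3"
    and "U \<noteq> 0" and "Z \<noteq> 0"
    and "bij (ratfun_eval V U)" and "bij (ratfun_eval W Z)"
    and "(degree V, degree U) \<in> PRF_degree_pairs d"
    and "(degree W, degree Z) \<in> PRF_degree_pairs d"
    and "Fract V U \<noteq> Fract W Z"
  shows "card {x. contract (ratfun_eval V U) x = contract (ratfun_eval W Z) x} \<le> d"
proof -
  have "card {x. contract (ratfun_eval V U) x = contract (ratfun_eval W Z) x}
    \<le> max (degree V + degree Z) (degree W + degree U)
      + (if degree V > degree U then 0 else 1) + (if degree W > degree Z then 0 else 1)"
    using card_contract_agreements_le[OF assms(5,6)]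
      card_ratfun_eval_agreements_le[OF assms(3,4,9)]
    by (auto split: if_splits)
  \<comment> \<open>This \<open>k\<close> is one less than the k in the overview: if infinity is
    fixed, the degrees are at most k + 1 above and k below; otherwise both are at most k -
    1.\<close>
  moreover obtain k where "d = 2 * k + 1"
    using assms(1) by (rule oddE)
  ultimately show ?thesis
    using assms(2,7,8) by (auto simp: PRF_degree_pairs_def split: if_splits)
qed

text \<open>Conjugation by \<open>h\<close> carries the points of disagreement along
  \<open>h\<close>. This moves permutations of the field to the symbols
  \<open>{..<q}\<close>.\<close>

lemma hamming_distance_map_permutation:
  assumes "bij_betw h A B" and "f ` A \<subseteq> A" and "g ` A \<subseteq> A"
  shows "hamming_distance B (map_permutation A h f) (map_permutation A h g) = hamming_distance A f g"
proof -
  have inj: "inj_on h A" and B: "B = h ` A"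
    using assms(1) by (auto simp: bij_betw_def)
  have "map_permutation A h f (h x) \<noteq> map_permutation A h g (h x) \<longleftrightarrow> f x \<noteq> g x" if "x \<in> A" for x
  proof -
    from that assms(2,3) have "f x \<in> A" "g x \<in> A" by blast+
    with that show ?thesis
      by (simp add: map_permutation_apply[OF inj] inj_on_eq_iff[OF inj])
  qed
  then have "{y \<in> B. map_permutation A h f y \<noteq> map_permutation A h g y} = h ` {x \<in> A. f x \<noteq> g x}"
    unfolding B by blast
  moreover have "inj_on h {x \<in> A. f x \<noteq> g x}"
    using inj by (rule inj_on_subset) auto
  ultimately show ?thesis
    by (simp add: hamming_distance_def card_image)
qed

lemma card_le_max_perm_code:
  fixes P :: "'i \<Rightarrow> 'a::finite \<Rightarrow> 'a"
  assumes q: "CARD('a) = q" and "D \<ge> 1"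
    and bij: "\<And>i. i \<in> I \<Longrightarrow> bij (P i)"
    and dist: "\<And>i j. i \<in> I \<Longrightarrow> j \<in> I \<Longrightarrow> i \<noteq> j \<Longrightarrow> D \<le> hamming_distance UNIV (P i) (P j)"
  shows "card I \<le> max_perm_code q D"
proof -
  obtain h :: "'a \<Rightarrow> nat" where h: "bij_betw h UNIV {..<q}"
    using ex_bij_betw_finite_nat[of "UNIV :: 'a set"] q by (auto simp: atLeast0LessThan)
  define c where "c i = map_permutation UNIV h (P i)" for i
  have far: "D \<le> hamming_distance {..<q} (c i) (c j)" if "i \<in> I" "j \<in> I" "i \<noteq> j" for i j
    using dist[OF that] by (simp add: c_def hamming_distance_map_permutation[OF h])
  have "is_perm_code q D (c ` I)"
    unfolding is_perm_code_def
  proof (intro conjI ballI impI)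
    fix \<pi> assume "\<pi> \<in> c ` I"
    then show "\<pi> permutes {..<q}"
      using bij by (auto simp: c_def intro!: map_permutation_permutes[OF h] bij_imp_permutes)
  qed (use far in blast)
  \<comment> \<open>Equal codewords have distance 0, so \<open>D \<ge> 1\<close> already forces
    distinct indices to give distinct codewords.\<close>
  moreover have "inj_on c I"
  proof (rule inj_onI, rule ccontr)
    fix i j assume "i \<in> I" "j \<in> I" "c i = c j" "i \<noteq> j"
    with far[of i j] \<open>D \<ge> 1\<close> show False
      by (simp add: hamming_distance_def)
  qed
  ultimately show ?thesis
    using perm_code_card_le card_image by metis
qed

(* The field with q elements is the type 'a; q is then automatically a prime power. *)
theorem theorem4p5:
  fixes d q :: nat
  assumes "odd d" and "d \<ge> 3"
    and "CARD('a::{field,finite}) = q"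
    and "q \<ge> d + 2"
  shows "max_perm_code q (q - d) \<ge> PRF_sum TYPE('a) d"
proof -
  define X :: "'a poly fract set" where "X = (\<Union>(v, u)\<in>PRF_degree_pairs d. PRFs v u)"
  have "PRF_sum TYPE('a) d = card X"
    unfolding X_def PRF_sum_def num_PRFs_def case_prod_unfold
    by (rule card_UN_disjoint[symmetric])
      (simp_all add: finite_PRF_degree_pairs finite_PRFs PRFs_disjoint prod_eq_iff)
  also have "\<dots> \<le> max_perm_code q (q - d)"
  proof -
    \<comment> \<open>One representative of each fraction is chosen, since evaluation is defined on
      pairs of polynomials.\<close>
    have "\<forall>r\<in>X. \<exists>V U. r = Fract V U \<and> U \<noteq> 0 \<and> bij (ratfun_eval V U) \<and>
        (degree V, degree U) \<in> PRF_degree_pairs d"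
      by (auto simp: X_def PRFs_def)
    then obtain V U where VU:
      "\<And>r. r \<in> X \<Longrightarrow> r = Fract (V r) (U r) \<and> U r \<noteq> 0 \<and> bij (ratfun_eval (V r) (U r)) \<and>
        (degree (V r), degree (U r)) \<in> PRF_degree_pairs d"
      by metis
    let ?P = "\<lambda>r. contract (ratfun_eval (V r) (U r))"
    show ?thesis
    proof (rule card_le_max_perm_code[where P = ?P])
      fix r s
      assume rs: "r \<in> X" "s \<in> X" "r \<noteq> s"
      then have "card {x. ?P r x = ?P s x} \<le> d"
        using VU by (intro card_contract_ratfun_agreements_le assms) metis+
      moreover have "{x. ?P r x \<noteq> ?P s x} = UNIV - {x. ?P r x = ?P s x}" by blast
      ultimately show "q - d \<le> hamming_distance UNIV (?P r) (?P s)"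
        using assms(3) by (simp add: hamming_distance_def card_Diff_subset)
    \<comment> \<open>The positivity of \<open>q - d\<close> comes from
      \<open>q \<ge> d + 2\<close>.\<close>
    qed (use assms VU bij_contract in auto)
  qed
  finally show ?thesis .
qed

end
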